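(* There exists a coded system $X$ which is mixing but has no periodic points with odd period. In particular, every set of generators for $X$ contains only words of even length.
   Context: Let $\mathcal A$ be a finite alphabet with at least two elements, $\mathcal A^{\mathbb Z}$ carry the product topology, and $\sigma$ be the shift map. A shift space is a closed shift-invariant subset $X\subset\mathcal A^{\mathbb Z}$; $\mathcal B(X)$ is the set of all finite words occurring in points of $X$, and $\mathcal B_n(X)$ the set of those of length $n$. A coded system is a shift space which is the closure in $\mathcal A^{\mathbb Z}$ of the set of label sequences of bi-infinite paths in some irreducible directed graph with at most countably many vertices and edges, whose edges are labeled by symbols of $\mathcal A$ (irreducible: every ordered pair of vertices is joined by a path). A set of generators for $X$ is a (possibly infinite) set $Q$ of words over $\mathcal A$ such that $X$ is the closure of the set of all bi-infinite concatenations of words from $Q$; equivalently, $\mathcal B(X)$ is the set of all subwords of finite concatenations of words from $Q$. A shift space is coded if and only if it has a set of generators. A shift space $X$ is mixing if for all $u,v\in\mathcal B(X)$ there is $N>0$ such that for every $n>N$ there is $w\in\mathcal B_n(X)$ with $uwv\in\mathcal B(X)$. *)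

theory Defs
  imports "HOL-Analysis.Analysis" "Graph_Theory.Digraph_Component"
begin

text \<open>
  The alphabet is a set \<open>A :: 'a set\<close>; points of the full shift are functions \<open>int \<Rightarrow> 'a\<close> with
  values in \<open>A\<close>, and words are lists.
\<close>

definition full_shift :: "'a set \<Rightarrow> (int \<Rightarrow> 'a) topology" where
  "full_shift A = product_topology (\<lambda>_. discrete_topology A) UNIV"

definition shift :: "(int \<Rightarrow> 'a) \<Rightarrow> (int \<Rightarrow> 'a)" where
  "shift x = (\<lambda>i. x (i + 1))"

definition shift_space :: "'a set \<Rightarrow> (int \<Rightarrow> 'a) set \<Rightarrow> bool" where
  "shift_space A X \<longleftrightarrow> closedin (full_shift A) X \<and> shift ` X = X"

definition block :: "(int \<Rightarrow> 'a) \<Rightarrow> int \<Rightarrow> nat \<Rightarrow> 'a list" where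
  "block x i n = map (\<lambda>k. x (i + int k)) [0..<n]"

definition language :: "(int \<Rightarrow> 'a) set \<Rightarrow> 'a list set" where
  "language X = {block x i n | x i n. x \<in> X}"

definition language_n :: "nat \<Rightarrow> (int \<Rightarrow> 'a) set \<Rightarrow> 'a list set" where
  "language_n n X = {w \<in> language X. length w = n}"

definition biinfinite_labels :: "('v, 'e) pre_digraph \<Rightarrow> ('e \<Rightarrow> 'a) \<Rightarrow> (int \<Rightarrow> 'a) set" where
  "biinfinite_labels G lab =
     {\<lambda>i. lab (p i) | p. \<forall>i. p i \<in> arcs G \<and> head G (p i) = tail G (p (i + 1))}"

text \<open>
  Vertices and edges are natural numbers: up to isomorphism these are exactly the directed
  multigraphs with at most countably many vertices and edges.
\<close>

definition coded_system :: "'a set \<Rightarrow> (int \<Rightarrow> 'a) set \<Rightarrow> bool" where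
  "coded_system A X \<longleftrightarrow> shift_space A X \<and>
     (\<exists>(G :: (nat, nat) pre_digraph) lab.
        wf_digraph G \<and> strongly_connected G \<and> lab ` arcs G \<subseteq> A \<and>
        X = full_shift A closure_of biinfinite_labels G lab)"

text \<open>
  \<open>c i\<close> is the position at which the \<open>i\<close>-th word starts. Strict monotonicity makes the positions
  unbounded in both directions. It only excludes occurrences of the empty word, and inserting
  empty words does not change the set of concatenations.
\<close>

definition biinfinite_concats :: "'a list set \<Rightarrow> (int \<Rightarrow> 'a) set" where
  "biinfinite_concats Q =
     {x. \<exists>c :: int \<Rightarrow> int. strict_mono c \<and>
           (\<forall>i. block x (c i) (nat (c (i + 1) - c i)) \<in> Q)}"

definition generators :: "'a set \<Rightarrow> 'a list set \<Rightarrow> (int \<Rightarrow> 'a) set \<Rightarrow> bool" where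
  "generators A Q X \<longleftrightarrow>
     Q \<subseteq> lists A \<and> X = full_shift A closure_of biinfinite_concats Q"

definition mixing :: "(int \<Rightarrow> 'a) set \<Rightarrow> bool" where
  "mixing X \<longleftrightarrow>
     (\<forall>u \<in> language X. \<forall>v \<in> language X. \<exists>N > 0. \<forall>n > N.
        \<exists>w \<in> language_n n X. u @ w @ v \<in> language X)"

definition periodic_point :: "(int \<Rightarrow> 'a) set \<Rightarrow> nat \<Rightarrow> (int \<Rightarrow> 'a) \<Rightarrow> bool" where
  "periodic_point X p x \<longleftrightarrow> x \<in> X \<and> p > 0 \<and> (shift ^^ p) x = x"

end

theory Submission
  imports Defs "HOL-Library.Sublist"
begin

text \<open>
  Let \<open>D\<close> be the smallest set of words over two letters \<open>a\<close>, \<open>b\<close> that is closed under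
  concatenation and under \<open>c \<mapsto> a (ab)\<^sup>m c (ab)\<^sup>m b\<close> with \<open>m\<close> the length of \<open>c\<close>, and let \<open>X\<close>
  consist of the points all of whose blocks are factors of words in \<open>D\<close>. All words in \<open>D\<close> have
  even length, but each \<open>c\<close> in \<open>D\<close> also occurs in another word of \<open>D\<close> at an odd offset; with the
  free insertion of \<open>ab\<close> this makes \<open>X\<close> mixing.

  Reading \<open>a\<close> and \<open>b\<close> as opening and closing parentheses, words in \<open>D\<close> are balanced. A factor of
  a word in \<open>D\<close> is \<open>s e p\<close> with \<open>e\<close> in \<open>D\<close>, where \<open>s\<close> is a suffix and \<open>p\<close> a prefix of a bracket
  \<open>a (ab)\<^sup>m c (ab)\<^sup>m b\<close>. An alternating run longer
  than \<open>q\<close> has no odd period \<open>q\<close>, and the runs \<open>(ab)\<^sup>m\<close> make up a fixed proportion of a bracket,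
  so \<open>s\<close> and \<open>p\<close> are short if the factor has odd period \<open>q\<close>. Then \<open>e\<close> covers a whole period.
  Balancedness forces the height gained over a period to be zero, so \<open>q\<close> is even after all.
\<close>

section \<open>Closures in the full shift, blocks, and periodic points built from words\<close>

lemma topspace_full_shift: "x \<in> topspace (full_shift A) \<longleftrightarrow> (\<forall>i. x i \<in> A)"
  by (auto simp: full_shift_def PiE_UNIV_domain)

text \<open>A basic open set of the product restricts only finitely many coordinates, so it contains
  a cylinder over some window \<open>{- int n..int n}\<close>, and such cylinders are themselves
  open. Approximation in the topology thus becomes agreement on finite windows.\<close>

lemma in_closure_full_shift:
  "x \<in> full_shift A closure_of S \<longleftrightarrow>
     (\<forall>i. x i \<in> A) \<and> (\<forall>n::nat. \<exists>y\<in>S \<inter> topspace (full_shift A). \<forall>i\<in>{- int n..int n}. y i = x i)"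
    (is "?L \<longleftrightarrow> ?R")
proof
  assume L: ?L
  then have x: "\<forall>i. x i \<in> A" by (auto simp: in_closure_of topspace_full_shift)
  have "\<exists>y\<in>S \<inter> topspace (full_shift A). \<forall>i\<in>{- int n..int n}. y i = x i" for n
  proof -
    define U where "U i = (if i \<in> {- int n..int n} then {x i} else A)" for i
    have "{i. U i \<noteq> A} \<subseteq> {- int n..int n}" by (auto simp: U_def)
    then have "finite {i. U i \<noteq> A}" by (rule finite_subset) simp
    then have "openin (full_shift A) (PiE UNIV U)"
      using x by (auto simp: full_shift_def openin_PiE_gen U_def)
    moreover have "x \<in> PiE UNIV U" using x by (auto simp: U_def)
    ultimately obtain y where "y \<in> S" "y \<in> PiE UNIV U"
      using L by (auto simp: in_closure_of)
    moreover from this have "y \<in> topspace (full_shift A)"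
      using \<open>openin _ _\<close> openin_subset by blast
    moreover have "y i = x i" if "i \<in> {- int n..int n}" for i
      using \<open>y \<in> PiE UNIV U\<close> that by (auto simp: U_def PiE_UNIV_domain Pi_iff dest: spec [of _ i])
    ultimately show ?thesis by blast
  qed
  then show ?R using x by blast
next
  assume R: ?R
  have "\<exists>y. y \<in> S \<and> y \<in> T" if T: "x \<in> T" "openin (full_shift A) T" for T
  proof -
    obtain U where U: "finite {i. U i \<noteq> A}" "x \<in> PiE UNIV U" "PiE UNIV U \<subseteq> T"
      using T(2) [unfolded full_shift_def openin_product_topology_alt, rule_format, OF T(1)]
      by auto
    obtain n where n: "{i. U i \<noteq> A} \<subseteq> {- int n..int n}"
    proof
      \<comment> \<open>The largest absolute value of a restricted coordinate. If no coordinate is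
        restricted, \<open>Max\<close> is unspecified, but the inclusion is then vacuous.\<close>
      let ?B = "(\<lambda>i. nat \<bar>i\<bar>) ` {i. U i \<noteq> A}"
      show "{i. U i \<noteq> A} \<subseteq> {- int (Max ?B)..int (Max ?B)}"
      proof
        fix i assume "i \<in> {i. U i \<noteq> A}"
        then have "nat \<bar>i\<bar> \<le> Max ?B" using U(1) by (intro Max_ge) auto
        then show "i \<in> {- int (Max ?B)..int (Max ?B)}" by auto
      qed
    qed
    obtain y where y: "y \<in> S" "\<forall>i. y i \<in> A" "\<forall>i\<in>{- int n..int n}. y i = x i"
      using R unfolding topspace_full_shift by (metis IntE topspace_full_shift)
    have "y i \<in> U i" for i
    proof (cases "U i = A")
      case False
      then have "y i = x i" using n y by blast
      then show ?thesis using U(2) by (auto simp: PiE_UNIV_domain)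
    qed (use y in simp)
    then have "y \<in> PiE UNIV U" by (simp add: PiE_UNIV_domain)
    then show ?thesis using y(1) U(3) by blast
  qed
  then show ?L using R by (auto simp: in_closure_of topspace_full_shift)
qed

lemma length_block [simp]: "length (block x i n) = n"
  by (simp add: block_def)

lemma nth_block [simp]: "k < n \<Longrightarrow> block x i n ! k = x (i + int k)"
  by (simp add: block_def)

lemma block_Suc: "block x i (Suc n) = block x i n @ [x (i + int n)]"
  by (simp add: block_def)

lemma block_cong: "(\<And>k. k < n \<Longrightarrow> x (i + int k) = y (j + int k)) \<Longrightarrow> block x i n = block y j n"
  by (simp add: block_def)

lemma shift_funpow: "(shift ^^ n) x = (\<lambda>i. x (i + int n))"
  by (induction n) (auto simp: shift_def ac_simps)

definition cyclic :: "'a list \<Rightarrow> int \<Rightarrow> 'a" where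
  "cyclic d i = d ! nat (i mod int (length d))"

lemma cyclic_nth: "k < length d \<Longrightarrow> cyclic d (int k) = d ! k"
  by (simp add: cyclic_def flip: of_nat_mod)

lemma cyclic_in: "d \<noteq> [] \<Longrightarrow> cyclic d i \<in> set d"
  unfolding cyclic_def by (intro nth_mem) (simp add: nat_less_iff)

lemma cyclic_add_length: "cyclic d (i + k * int (length d)) = cyclic d i"
  by (simp add: cyclic_def)

definition block_shift :: "'a list set \<Rightarrow> (int \<Rightarrow> 'a) set" where
  "block_shift F = {x. \<forall>i n. block x i n \<in> F}"

lemma shift_block_shift: "shift ` block_shift F = block_shift F"
proof -
  have "shift x \<in> block_shift F" if "x \<in> block_shift F" for x
  proof -
    have "block (shift x) i n = block x (i + 1) n" for i n
      by (rule block_cong) (simp add: shift_def ac_simps)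
    then show ?thesis using that by (simp add: block_shift_def)
  qed
  moreover have "x \<in> shift ` block_shift F" if "x \<in> block_shift F" for x
  proof
    show "x = shift (\<lambda>i. x (i - 1))" by (simp add: shift_def)
    have "block (\<lambda>i. x (i - 1)) i n = block x (i - 1) n" for i n
      by (rule block_cong) (simp add: algebra_simps)
    then show "(\<lambda>i. x (i - 1)) \<in> block_shift F" using that by (simp add: block_shift_def)
  qed
  ultimately show ?thesis by blast
qed

section \<open>Coded systems from monoids of words over a countable alphabet\<close>

locale word_monoid =
  fixes A :: "'a set" and D :: "'a list set"
  assumes countable: "countable A"
    and words: "D \<subseteq> lists A"
    and Nil: "[] \<in> D"
    and append: "c \<in> D \<Longrightarrow> d \<in> D \<Longrightarrow> c @ d \<in> D"
    and nontrivial: "\<exists>d\<in>D. d \<noteq> []"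
begin

abbreviation subwords :: "'a list set" where
  "subwords \<equiv> {f. \<exists>d\<in>D. sublist f d}"

definition states :: "'a list set" where
  "states = {u. \<exists>d\<in>D. prefix u d}"

text \<open>The transitions of the prefix tree of \<open>D\<close>, with a return to the root
  \<open>[]\<close> whenever a letter completes a word of \<open>D\<close>. The return is optional,
  because that word may be a proper prefix of another one.\<close>

definition edges :: "('a list \<times> 'a \<times> 'a list) set" where
  "edges = {(u, s, v). u \<in> states \<and> v \<in> states \<and> (v = u @ [s] \<or> v = [] \<and> u @ [s] \<in> D)}"

text \<open>\<open>coded_system\<close> asks for natural numbers as vertices and edges, so states
  and labeled transitions are numbered by \<open>to_nat_on\<close>.\<close>

definition prefix_graph :: "(nat, nat) pre_digraph" where
  "prefix_graph = \<lparr>verts = to_nat_on states ` states, arcs = to_nat_on edges ` edges,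
        tail = (\<lambda>e. to_nat_on states (fst (from_nat_into edges e))),
        head = (\<lambda>e. to_nat_on states (snd (snd (from_nat_into edges e))))\<rparr>"

definition lab :: "nat \<Rightarrow> 'a" where
  "lab e = fst (snd (from_nat_into edges e))"

lemma states_lists: "states \<subseteq> lists A"
  using words set_mono_prefix by (fastforce simp: states_def)

lemma countable_states: "countable states"
  using states_lists countable by (rule countable_subset [OF _ countable_lists])

lemma edges_subset: "edges \<subseteq> lists A \<times> A \<times> lists A"
proof -
  have "s \<in> A" if "(u, s, v) \<in> edges" for u s v
    using that states_lists words by (fastforce simp: edges_def)
  then show ?thesis using states_lists by (auto simp: edges_def)
qed

lemma countable_edges: "countable edges"
  using edges_subset by (rule countable_subset) (intro countable_SIGMA countable_lists countable)

lemma from_nat_into_edges [simp]: "e \<in> edges \<Longrightarrow> from_nat_into edges (to_nat_on edges e) = e"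
  by (simp add: countable_edges)

lemma Nil_states: "[] \<in> states" using Nil by (auto simp: states_def)

lemma D_subset_states: "D \<subseteq> states" by (auto simp: states_def)

lemma snoc_states: "u @ [s] \<in> states \<Longrightarrow> u \<in> states"
  by (auto simp: states_def intro: append_prefixD)

lemma wf_prefix_graph: "wf_digraph prefix_graph"
proof -
  have "fst e \<in> states" "snd (snd e) \<in> states" if "e \<in> edges" for e
    using that by (auto simp: edges_def)
  then show ?thesis by unfold_locales (auto simp: prefix_graph_def)
qed

lemma lab_arcs: "lab ` arcs prefix_graph \<subseteq> A"
  using edges_subset by (auto simp: lab_def prefix_graph_def)

lemma edge_adj: "(u, s, v) \<in> edges \<Longrightarrow> (to_nat_on states u, to_nat_on states v) \<in> arcs_ends prefix_graph"
  by (force simp: arcs_ends_conv prefix_graph_def image_image)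

lemma verts_prefix_graph: "u \<in> states \<Longrightarrow> to_nat_on states u \<in> verts prefix_graph"
  by (simp add: prefix_graph_def)

lemma reach_append: "u @ w \<in> states \<Longrightarrow> to_nat_on states u \<rightarrow>\<^sup>*\<^bsub>prefix_graph\<^esub> to_nat_on states (u @ w)"
proof (induction w rule: rev_induct)
  case Nil
  then show ?case using verts_prefix_graph by (simp add: wf_digraph.reachable_refl [OF wf_prefix_graph])
next
  case (snoc s w)
  then have w: "u @ w \<in> states" using snoc_states [of "u @ w" s] by simp
  have "(u @ w, s, u @ w @ [s]) \<in> edges" using snoc w by (simp add: edges_def)
  then show ?case
    using snoc.IH [OF w] wf_digraph.reachable_adj_trans [OF wf_prefix_graph] edge_adj by blast
qed

text \<open>Some nonempty continuation of \<open>u\<close> completes a word of \<open>D\<close>; its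
  last letter can be read along a return edge.\<close>

lemma reach_Nil:
  assumes "u \<in> states"
  shows "to_nat_on states u \<rightarrow>\<^sup>*\<^bsub>prefix_graph\<^esub> to_nat_on states []"
proof (cases "u = []")
  case False
  obtain w where w: "u @ w \<in> D" using assms by (auto simp: states_def prefix_def)
  \<comment> \<open>A return edge reads at least one letter. If the only completion at hand is
    \<open>u\<close> itself, the word \<open>u @ u\<close> supplies a nonempty one.\<close>
  obtain w' where "u @ w' \<in> D" "w' \<noteq> []"
  proof (cases "w = []")
    case True
    then show ?thesis using that [of u] append [OF w w] False by simp
  qed (use w that in blast)
  then obtain t s where t: "(u @ t) @ [s] \<in> D"
    by (metis append.assoc rev_exhaust)
  then have "(u @ t) @ [s] \<in> states" using D_subset_states by blast
  then have ut: "u @ t \<in> states" by (rule snoc_states)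
  then have "(u @ t, s, []) \<in> edges" using t Nil_states by (simp add: edges_def)
  then show ?thesis
    using reach_append [OF ut] wf_digraph.reachable_adj_trans [OF wf_prefix_graph] edge_adj by blast
qed (use reach_append [of "[]" "[]"] Nil_states in simp)

lemma strongly_connected_prefix_graph: "strongly_connected prefix_graph"
  unfolding strongly_connected_def
proof (intro conjI ballI)
  show "verts prefix_graph \<noteq> {}" using verts_prefix_graph [OF Nil_states] by blast
  fix x y assume "x \<in> verts prefix_graph" "y \<in> verts prefix_graph"
  then obtain u v where "x = to_nat_on states u" "u \<in> states" "y = to_nat_on states v" "v \<in> states"
    by (auto simp: prefix_graph_def)
  then show "x \<rightarrow>\<^sup>*\<^bsub>prefix_graph\<^esub> y"
    using reach_Nil [of u] reach_append [of "[]" v] wf_digraph.reachable_trans [OF wf_prefix_graph] by auto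
qed

text \<open>A state records the part of the current word read so far. The start state together with
  the labels read is therefore a product of completed words followed by the present state, and
  completing that state gives a word of \<open>D\<close> around the block.\<close>

lemma labels_blocks:
  assumes "x \<in> biinfinite_labels prefix_graph lab"
  shows "block x i n \<in> subwords"
proof -
  obtain p where x: "x = (\<lambda>i. lab (p i))" and p: "\<And>i. p i \<in> arcs prefix_graph"
    "\<And>i. head prefix_graph (p i) = tail prefix_graph (p (i + 1))"
    using assms by (auto simp: biinfinite_labels_def)
  define e where "e i = from_nat_into edges (p i)" for i
  define u where "u i = fst (e i)" for i
  have e: "e i \<in> edges" for i
    using p(1) [of i] by (auto simp: e_def prefix_graph_def)
  have u: "u i \<in> states" for i
    using e [of i] by (auto simp: edges_def u_def)
  have nxt: "snd (snd (e i)) = u (i + 1)" for i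
  proof -
    have "snd (snd (e i)) \<in> states" using e [of i] by (auto simp: edges_def)
    moreover have "to_nat_on states (snd (snd (e i))) = to_nat_on states (u (i + 1))"
      using p(2) [of i] by (simp add: prefix_graph_def e_def u_def)
    ultimately show ?thesis
      using u [of "i + 1"] countable_states by (metis from_nat_into_to_nat_on)
  qed
  have step: "u (i + 1) = u i @ [x i] \<or> u (i + 1) = [] \<and> u i @ [x i] \<in> D" for i
    using e [of i] nxt [of i] by (auto simp: edges_def u_def x lab_def e_def)
  \<comment> \<open>Here \<open>d\<close> collects the words completed between the times
    \<open>i\<close> and \<open>i + int n\<close>.\<close>
  have "\<exists>d\<in>D. u i @ block x i n = d @ u (i + int n)"
  proof (induction n)
    case 0
    show ?case using Nil by (auto simp: block_def intro: bexI [of _ "[]"])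
  next
    case (Suc n)
    then obtain d where d: "d \<in> D" "u i @ block x i n = d @ u (i + int n)" by blast
    have eq: "u i @ block x i (Suc n) = d @ u (i + int n) @ [x (i + int n)]"
      using arg_cong [OF d(2), of "\<lambda>w. w @ [x (i + int n)]"] by (simp add: block_Suc)
    have i: "i + int (Suc n) = i + int n + 1" by simp
    show ?case
      using step [of "i + int n"]
    proof
      assume "u (i + int n + 1) = u (i + int n) @ [x (i + int n)]"
      then show ?thesis unfolding i using eq d(1) by metis
    next
      assume "u (i + int n + 1) = [] \<and> u (i + int n) @ [x (i + int n)] \<in> D"
      then show ?thesis unfolding i using eq append [OF d(1)] by (metis append_Nil2)
    qed
  qed
  then obtain d where d: "d \<in> D" "u i @ block x i n = d @ u (i + int n)" by blast
  obtain w where w: "u (i + int n) @ w \<in> D"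
    using u [of "i + int n"] by (auto simp: states_def prefix_def)
  have "u i @ block x i n @ w = d @ u (i + int n) @ w"
    using arg_cong [OF d(2), of "\<lambda>v. v @ w"] by simp
  then have "u i @ block x i n @ w \<in> D" using append [OF d(1) w] by metis
  then show ?thesis using sublist_appendI by blast
qed

text \<open>Repeating \<open>d\<close> means descending the branch of \<open>d\<close> from the root
  and returning on its last letter. \<open>j i\<close> is the depth before the letter at time
  \<open>i\<close>, and \<open>r i\<close> the depth after it. The offset \<open>k\<close> allows a
  copy of \<open>d\<close> to be placed at any position.\<close>

lemma cyclic_labels:
  assumes "d \<in> D" "d \<noteq> []"
  shows "(\<lambda>i. cyclic d (i + k)) \<in> biinfinite_labels prefix_graph lab"
proof -
  let ?l = "int (length d)"
  define j where "j i = nat ((i + k) mod ?l)" for i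
  define r where "r i = (if Suc (j i) < length d then Suc (j i) else 0)" for i
  define e where "e i = (take (j i) d, d ! j i, take (r i) d)" for i
  have l: "?l > 0" using assms(2) by simp
  have j: "j i < length d" for i
    using l by (simp add: j_def nat_less_iff)
  have jint: "int (j i) = (i + k) mod ?l" for i
    using l by (simp add: j_def)
  have r: "r i = j (i + 1)" for i
  proof -
    have "int (j (i + 1)) = (int (j i) + 1) mod ?l"
      unfolding jint mod_add_left_eq by (simp add: ac_simps)
    also have "\<dots> = int (Suc (j i) mod length d)"
      by (simp add: zmod_int ac_simps)
    also have "\<dots> = int (r i)"
      using j [of i] by (cases "Suc (j i) = length d") (auto simp: r_def)
    finally show ?thesis by simp
  qed
  have states: "take n d \<in> states" for n
    using assms(1) take_is_prefix by (auto simp: states_def)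
  have e: "e i \<in> edges" for i
  proof (cases "Suc (j i) < length d")
    case True
    then have "take (Suc (j i)) d = take (j i) d @ [d ! j i]"
      by (simp add: take_Suc_conv_app_nth)
    then show ?thesis using True states by (metis (mono_tags, lifting) case_prodI edges_def e_def mem_Collect_eq r_def)
  next
    case False
    then have "Suc (j i) = length d" using j [of i] by simp
    then have "take (j i) d @ [d ! j i] = d"
      by (metis take_Suc_conv_app_nth j take_all order_refl)
    then show ?thesis using states [of "j i"] Nil_states assms(1) False by (simp add: edges_def e_def r_def)
  qed
  have "(\<lambda>i. cyclic d (i + k)) = (\<lambda>i. lab (to_nat_on edges (e i)))"
    using e by (auto simp: lab_def cyclic_def e_def j_def)
  moreover have "to_nat_on edges (e i) \<in> arcs prefix_graph" for i
    using e by (simp add: prefix_graph_def)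
  moreover have "head prefix_graph (to_nat_on edges (e i)) = tail prefix_graph (to_nat_on edges (e (i + 1)))" for i
    using e by (simp add: prefix_graph_def) (simp add: e_def r)
  ultimately show ?thesis
    unfolding biinfinite_labels_def by (intro CollectI exI [of _ "\<lambda>i. to_nat_on edges (e i)"]) simp
qed

lemma cyclic_extension:
  assumes "f \<in> subwords"
  obtains y where "y \<in> biinfinite_labels prefix_graph lab" "block y i (length f) = f"
proof -
  obtain d where d: "d \<in> D" "sublist f d" using assms by blast
  \<comment> \<open>\<open>d\<close> may be empty, and only nonempty words can be repeated;
    appending \<open>d'\<close> repairs this.\<close>
  obtain d' where d': "d' \<in> D" "d' \<noteq> []" using nontrivial by blast
  have dd: "d @ d' \<in> D" "d @ d' \<noteq> []" using d d' append by auto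
  obtain ps ss where s: "d @ d' = ps @ f @ ss"
    using d(2) by (auto simp: sublist_def)
  let ?y = "\<lambda>j. cyclic (d @ d') (j + (int (length ps) - i))"
  have "block ?y i (length f) = f"
  proof (rule nth_equalityI)
    fix n assume "n < length (block ?y i (length f))"
    then have n: "n < length f" by simp
    have "block ?y i (length f) ! n = cyclic (d @ d') (int (length ps + n))"
      using n by (simp add: ac_simps)
    also have "\<dots> = (d @ d') ! (length ps + n)"
      by (rule cyclic_nth) (use n in \<open>simp add: s\<close>)
    also have "\<dots> = f ! n" using n by (simp add: s nth_append)
    finally show "block ?y i (length f) ! n = f ! n" .
  qed simp
  then show ?thesis using that cyclic_labels [OF dd] by blast
qed

lemma block_shift_in: "x \<in> block_shift subwords \<Longrightarrow> x i \<in> A"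
proof -
  assume "x \<in> block_shift subwords"
  then have "block x i 1 \<in> subwords" by (simp only: block_shift_def mem_Collect_eq)
  then obtain d where "d \<in> D" "sublist (block x i 1) d" by blast
  then show "x i \<in> A"
    using words set_mono_sublist [of "block x i 1" d] by (auto simp: block_def)
qed

text \<open>Each block of a limit point is already a block of a label sequence. Conversely, the
  central block of a point of the block shift also occurs, at the same place, in a periodic label
  sequence. Besides giving the coded presentation, this shows that the block shift is
  closed.\<close>

lemma closure_labels: "full_shift A closure_of biinfinite_labels prefix_graph lab = block_shift subwords"
proof (intro equalityI subsetI)
  fix x assume x: "x \<in> full_shift A closure_of biinfinite_labels prefix_graph lab"
  have "block x i n \<in> subwords" for i n
  proof -
    obtain y where y: "y \<in> biinfinite_labels prefix_graph lab"
      "\<forall>j\<in>{- int (nat \<bar>i\<bar> + n)..int (nat \<bar>i\<bar> + n)}. y j = x j"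
      using x unfolding in_closure_full_shift by blast
    have "block x i n = block y i n"
      by (rule block_cong) (intro y(2) [rule_format, symmetric], auto)
    then show ?thesis using labels_blocks [OF y(1)] by simp
  qed
  then show "x \<in> block_shift subwords" by (simp add: block_shift_def)
next
  fix x assume x: "x \<in> block_shift subwords"
  have "\<exists>y\<in>biinfinite_labels prefix_graph lab \<inter> topspace (full_shift A). \<forall>i\<in>{- int n..int n}. y i = x i" for n
  proof -
    have "block x (- int n) (2 * n + 1) \<in> subwords" using x by (simp only: block_shift_def mem_Collect_eq)
    then obtain y where y: "y \<in> biinfinite_labels prefix_graph lab"
      "block y (- int n) (2 * n + 1) = block x (- int n) (2 * n + 1)"
      by (rule cyclic_extension) simp
    have "y i = x i" if "i \<in> {- int n..int n}" for i
    proof -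
      have "nat (i + int n) < 2 * n + 1" "- int n + int (nat (i + int n)) = i"
        using that by auto
      then show ?thesis using y(2) nth_block by metis
    qed
    moreover have "y \<in> block_shift subwords"
      using labels_blocks [OF y(1)] unfolding block_shift_def by blast
    then have "y \<in> topspace (full_shift A)"
      using block_shift_in by (simp add: topspace_full_shift)
    ultimately show ?thesis using y(1) by blast
  qed
  then show "x \<in> full_shift A closure_of biinfinite_labels prefix_graph lab"
    using block_shift_in [OF x] by (simp add: in_closure_full_shift)
qed

lemma coded_system_block_shift: "coded_system A (block_shift subwords)"
  unfolding coded_system_def shift_space_def
  using wf_prefix_graph strongly_connected_prefix_graph lab_arcs shift_block_shift
  by (metis closure_labels closedin_closure_of)

lemma labels_subset: "biinfinite_labels prefix_graph lab \<subseteq> block_shift subwords"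
  using labels_blocks unfolding block_shift_def by blast

lemma language_block_shift: "language (block_shift subwords) = subwords"
proof (intro equalityI subsetI)
  fix f assume "f \<in> subwords"
  then obtain y where "y \<in> biinfinite_labels prefix_graph lab" "block y 0 (length f) = f"
    by (rule cyclic_extension)
  then show "f \<in> language (block_shift subwords)"
    using labels_subset unfolding language_def by (metis (mono_tags, lifting) mem_Collect_eq subsetD)
qed (auto simp: language_def block_shift_def)

end

text \<open>The repetition of \<open>w\<close> is a concatenation of words of \<open>Q\<close>, cut
  at the multiples of \<open>length w\<close>. Oddness ensures that \<open>w\<close> is nonempty.
  Absence of odd periods therefore forces all generators to have even length.\<close>

lemma generators_odd_word:
  assumes "generators A Q X" "w \<in> Q" "odd (length w)"
  shows "periodic_point X (length w) (cyclic w)"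
proof -
  let ?l = "int (length w)"
  have l: "?l > 0" using assms(3) by (cases w) auto
  have "block (cyclic w) (i * ?l) (nat ((i + 1) * ?l - i * ?l)) = w" for i
  proof (rule nth_equalityI)
    fix n assume "n < length (block (cyclic w) (i * ?l) (nat ((i + 1) * ?l - i * ?l)))"
    then have "n < length w" by (simp add: algebra_simps)
    then show "block (cyclic w) (i * ?l) (nat ((i + 1) * ?l - i * ?l)) ! n = w ! n"
      using cyclic_add_length [of w "int n" i]
      by (simp add: algebra_simps cyclic_nth)
  qed (simp add: algebra_simps)
  moreover have "strict_mono (\<lambda>i. i * ?l)" using l by (simp add: strict_mono_def)
  ultimately have "cyclic w \<in> biinfinite_concats Q"
    using assms(2) unfolding biinfinite_concats_def by fastforce
  moreover have "w \<in> lists A" "w \<noteq> []" using assms l by (auto simp: generators_def)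
  then have "cyclic w \<in> topspace (full_shift A)"
    using cyclic_in [of w] by (auto simp: topspace_full_shift)
  ultimately have "cyclic w \<in> X"
    using assms(1) closure_of_subset_Int by (fastforce simp: generators_def)
  moreover have "(shift ^^ length w) (cyclic w) = cyclic w"
    using cyclic_add_length [of w _ 1] by (simp add: shift_funpow)
  ultimately show ?thesis using l by (simp add: periodic_point_def)
qed

text \<open>Holds vacuously if \<open>length s\<close> is at most \<open>q\<close>, so its uses come
  with length bounds.\<close>

definition has_period :: "nat \<Rightarrow> 'a list \<Rightarrow> bool" where
  "has_period q s \<longleftrightarrow> (\<forall>i. i + q < length s \<longrightarrow> s ! i = s ! (i + q))"

lemma has_period_sublist:
  assumes "has_period q t" and "sublist s t"
  shows "has_period q s"
proof -
  obtain ps ss where t: "t = ps @ s @ ss"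
    using assms(2) by (auto simp: sublist_def)
  have "s ! i = s ! (i + q)" if "i + q < length s" for i
  proof -
    have "t ! (length ps + i) = t ! (length ps + i + q)"
      using assms(1) [unfolded has_period_def, rule_format, of "length ps + i"] that
      by (simp add: t)
    moreover have "t ! (length ps + i) = s ! i"
      using that by (auto simp: t nth_append)
    moreover have "t ! (length ps + i + q) = s ! (i + q)"
      using that by (auto simp: t nth_append add.assoc)
    ultimately show ?thesis by simp
  qed
  then show ?thesis by (simp add: has_period_def)
qed

section \<open>The words of the construction, their heights and balance\<close>

locale two_letters =
  fixes a b :: 'a
  assumes distinct: "a \<noteq> b"
begin

definition height :: "'a list \<Rightarrow> int" where
  "height w = (\<Sum>s\<leftarrow>w. if s = a then 1 else -1)"

definition balanced :: "'a list \<Rightarrow> bool" where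
  "balanced w \<longleftrightarrow> height w = 0 \<and> (\<forall>t. prefix t w \<longrightarrow> 0 \<le> height t)"

definition alt :: "nat \<Rightarrow> 'a list" where
  "alt m = concat (replicate m [a, b])"

text \<open>The inner \<open>c\<close> starts at the odd offset \<open>2 * length c + 1\<close>. The
  total length is \<open>5 * length c + 2\<close>, so a bound on one alternating run, of length
  \<open>2 * length c\<close>, bounds the whole bracket.\<close>

definition wrap :: "'a list \<Rightarrow> 'a list" where
  "wrap c = [a] @ (alt (length c) @ c @ alt (length c)) @ [b]"

text \<open>\<open>wrap []\<close> is \<open>[a, b]\<close>, so alternating words need no rule of
  their own.\<close>

inductive_set code :: "'a list set" where
  Nil: "[] \<in> code"
| append: "c \<in> code \<Longrightarrow> d \<in> code \<Longrightarrow> c @ d \<in> code"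
| wrap: "c \<in> code \<Longrightarrow> wrap c \<in> code"

definition factors :: "'a list set" where
  "factors = {f. \<exists>d\<in>code. sublist f d}"

lemma height_append [simp]: "height (u @ v) = height u + height v"
  and height_Nil [simp]: "height [] = 0"
  and height_a [simp]: "height (a # v) = 1 + height v"
  and height_b [simp]: "height (b # v) = height v - 1"
  using distinct by (auto simp: height_def)

text \<open>Each letter changes the height by 1 or -1. Through this parity, height zero yields even
  length.\<close>

lemma even_height_iff: "even (height w) \<longleftrightarrow> even (length w)"
  by (induction w) (auto simp: height_def)

lemma alt_0 [simp]: "alt 0 = []"
  and alt_Suc [simp]: "alt (Suc m) = [a, b] @ alt m"
  by (simp_all add: alt_def)

lemma length_alt [simp]: "length (alt m) = 2 * m"
  by (induction m) auto

lemma nth_alt: "i < 2 * m \<Longrightarrow> alt m ! i = (if even i then a else b)"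
proof (induction m arbitrary: i)
  case (Suc m)
  show ?case
  proof (cases "i < 2")
    case True
    then have "i = 0 \<or> i = 1" by auto
    then show ?thesis by auto
  next
    case False
    then obtain j where i: "i = Suc (Suc j)"
      by (metis add_2_eq_Suc le_Suc_ex not_less)
    show ?thesis using Suc by (auto simp: i)
  qed
qed simp

lemma alt_code: "alt m \<in> code"
proof (induction m)
  case 0
  show ?case by (simp add: code.Nil)
next
  case (Suc m)
  have "wrap [] \<in> code" by (intro code.wrap code.Nil)
  then have "[a, b] \<in> code" by (simp add: wrap_def)
  then show ?case using Suc code.append by (metis alt_Suc)
qed

lemma balanced_append: "balanced u \<Longrightarrow> balanced v \<Longrightarrow> balanced (u @ v)"
  by (auto simp: balanced_def prefix_append)

lemma balanced_alt: "balanced (alt m)"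
proof (induction m)
  case (Suc m)
  have "balanced [a, b]" by (auto simp: balanced_def prefix_Cons)
  then show ?case using Suc balanced_append by (metis alt_Suc)
qed (simp add: balanced_def)

text \<open>The opening \<open>a\<close> raises all heights inside by one, which pays for the
  closing \<open>b\<close>.\<close>

lemma balanced_wrap:
  assumes "balanced c"
  shows "balanced (wrap c)"
proof -
  define g where "g = alt (length c) @ c @ alt (length c)"
  have g: "balanced g"
    unfolding g_def by (intro balanced_append balanced_alt assms)
  have "0 \<le> height t" if "prefix t (a # g @ [b])" for t
    using that g by (cases t) (auto simp: balanced_def add_nonneg_nonneg)
  then show ?thesis
    using g by (simp add: wrap_def balanced_def flip: g_def)
qed

lemma balanced_code: "c \<in> code \<Longrightarrow> balanced c"
  by (induction rule: code.induct)
     (auto intro: balanced_append balanced_wrap simp: balanced_def [of "[]"])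

lemma code_subset: "code \<subseteq> lists {a, b}"
proof
  have alt: "set (alt m) \<subseteq> {a, b}" for m by (induction m) auto
  fix c assume "c \<in> code"
  then have "set c \<subseteq> {a, b}"
  proof induction
    case (wrap c)
    then show ?case using alt [of "length c"] by (auto simp: wrap_def)
  qed auto
  then show "c \<in> lists {a, b}" by auto
qed

section \<open>Decomposition of factors into a suffix of a bracket, a code word and a prefix of a
  bracket\<close>

text \<open>Factors, suffixes and prefixes are treated together, since a factor of a concatenation
  may straddle the cut and then consists of a suffix and a prefix.\<close>

definition splits :: "'a list \<Rightarrow> bool" where
  "splits w \<longleftrightarrow>
     (\<forall>f. sublist f w \<longrightarrow> (\<exists>c\<in>code. \<exists>e\<in>code. \<exists>c'\<in>code. \<exists>s p.
        f = s @ e @ p \<and> suffix s (wrap c) \<and> prefix p (wrap c'))) \<and>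
     (\<forall>f. suffix f w \<longrightarrow> (\<exists>c\<in>code. \<exists>e\<in>code. \<exists>s. f = s @ e \<and> suffix s (wrap c))) \<and>
     (\<forall>f. prefix f w \<longrightarrow> (\<exists>e\<in>code. \<exists>c\<in>code. \<exists>p. f = e @ p \<and> prefix p (wrap c)))"

text \<open>At the cut, the code words \<open>e\<close> and \<open>e'\<close> of the two sides meet
  and merge into the code word \<open>e @ e'\<close>.\<close>

lemma splits_append:
  assumes "splits u" "splits v" and uv: "u \<in> code" "v \<in> code"
  shows "splits (u @ v)"
  unfolding splits_def
proof (intro conjI allI impI)
  fix f assume "sublist f (u @ v)"
  then consider "sublist f u" | "sublist f v" |
    f1 f2 where "f = f1 @ f2" "suffix f1 u" "prefix f2 v"
    by (auto simp: sublist_append)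
  then show "\<exists>c\<in>code. \<exists>e\<in>code. \<exists>c'\<in>code. \<exists>s p.
        f = s @ e @ p \<and> suffix s (wrap c) \<and> prefix p (wrap c')"
  proof cases
    case 3
    obtain c e s where "c \<in> code" "e \<in> code" "f1 = s @ e" "suffix s (wrap c)"
      using assms(1) 3 by (auto simp: splits_def)
    moreover obtain e' c' p where "c' \<in> code" "e' \<in> code" "f2 = e' @ p" "prefix p (wrap c')"
      using assms(2) 3 by (auto simp: splits_def)
    ultimately have "f = s @ (e @ e') @ p" "e @ e' \<in> code"
      using 3 by (auto intro: code.append)
    then show ?thesis
      using \<open>c \<in> code\<close> \<open>c' \<in> code\<close> \<open>suffix s (wrap c)\<close> \<open>prefix p (wrap c')\<close> by blast
  qed (use assms in \<open>auto simp: splits_def\<close>)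
next
  fix f assume "suffix f (u @ v)"
  then consider "suffix f v" | f' where "f = f' @ v" "suffix f' u"
    by (auto simp: suffix_append)
  then show "\<exists>c\<in>code. \<exists>e\<in>code. \<exists>s. f = s @ e \<and> suffix s (wrap c)"
  proof cases
    case 2
    then obtain c e s where "c \<in> code" "e \<in> code" "f' = s @ e" "suffix s (wrap c)"
      using assms(1) by (auto simp: splits_def)
    then show ?thesis using 2 code.append [OF _ uv(2)] by (metis append.assoc)
  qed (use assms in \<open>auto simp: splits_def\<close>)
next
  fix f assume "prefix f (u @ v)"
  then consider "prefix f u" | f' where "f = u @ f'" "prefix f' v"
    by (auto simp: prefix_append)
  then show "\<exists>e\<in>code. \<exists>c\<in>code. \<exists>p. f = e @ p \<and> prefix p (wrap c)"
  proof cases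
    case 2
    then obtain c e p where "c \<in> code" "e \<in> code" "f' = e @ p" "prefix p (wrap c)"
      using assms(2) by (auto simp: splits_def)
    then show ?thesis using 2 code.append [OF uv(1)] by (metis append.assoc)
  qed (use assms in \<open>auto simp: splits_def\<close>)
qed

text \<open>A factor that contains an end letter of the bracket is a prefix or suffix of it and
  serves as \<open>p\<close> or \<open>s\<close> with \<open>e\<close> empty; any other factor lies
  in the interior \<open>g\<close>. Keeping \<open>g\<close> as a variable covers
  \<open>wrap []\<close> with empty interior as well.\<close>

lemma splits_wrap_aux:
  assumes c: "c \<in> code" and g: "wrap c = [a] @ g @ [b]" "splits g"
  shows "splits (wrap c)"
  unfolding splits_def
proof (intro conjI allI impI)
  fix f assume "sublist f (wrap c)"
  then consider "prefix f (wrap c)" | "suffix f (wrap c)" | "sublist f g"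
    using suffix_ConsI [of f "g @ [b]" a]
    by (auto simp: g(1) sublist_Cons_right sublist_snoc)
  then show "\<exists>c\<in>code. \<exists>e\<in>code. \<exists>c'\<in>code. \<exists>s p.
        f = s @ e @ p \<and> suffix s (wrap c) \<and> prefix p (wrap c')"
  proof cases
    case 1
    have "f = [] @ [] @ f" by simp
    then show ?thesis using 1 c code.Nil by (metis Nil_suffix)
  next
    case 2
    have "f = f @ [] @ []" by simp
    then show ?thesis using 2 c code.Nil by (metis Nil_prefix)
  qed (use g(2) in \<open>auto simp: splits_def\<close>)
next
  fix f assume "suffix f (wrap c)"
  then show "\<exists>c\<in>code. \<exists>e\<in>code. \<exists>s. f = s @ e \<and> suffix s (wrap c)"
    using c code.Nil by (metis append_Nil2)
next
  fix f assume "prefix f (wrap c)"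
  then show "\<exists>e\<in>code. \<exists>c\<in>code. \<exists>p. f = e @ p \<and> prefix p (wrap c)"
    using c code.Nil by (metis append_Nil)
qed

lemma splits_Nil: "splits []"
proof -
  have "[] = [] @ [] @ ([] :: 'a list)" "[] = [] @ ([] :: 'a list)" by simp_all
  then show ?thesis
    unfolding splits_def using code.Nil by (auto intro!: bexI [of _ "[]"])
qed

lemma splits_alt: "splits (alt m)"
proof (induction m)
  case (Suc m)
  have ab: "wrap [] = [a, b]" by (simp add: wrap_def)
  have "splits (wrap [])"
    by (rule splits_wrap_aux [OF code.Nil _ splits_Nil]) (simp add: ab)
  moreover have "wrap [] \<in> code" by (intro code.wrap code.Nil)
  ultimately show ?case using Suc splits_append alt_code ab by (metis alt_Suc)
qed (simp add: splits_Nil)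

lemma splits_code: "c \<in> code \<Longrightarrow> splits c"
proof (induction rule: code.induct)
  case (wrap c)
  have "splits (alt (length c) @ c @ alt (length c))"
    using wrap by (intro splits_append splits_alt alt_code code.append)
  then show ?case using splits_wrap_aux wrap by (metis wrap_def)
qed (auto intro: splits_append splits_Nil)

section \<open>Length bounds for words with an odd period\<close>

text \<open>In an alternating word, letters at odd distance differ; compare positions 0 and
  \<open>q\<close> of \<open>s\<close>.\<close>

lemma alternating_period_bound:
  assumes "has_period q s" "odd q" "sublist s (alt m)"
  shows "length s \<le> q"
proof (rule ccontr)
  assume "\<not> length s \<le> q"
  then have len: "q < length s" by simp
  obtain ps ss where alt: "alt m = ps @ s @ ss"
    using assms(3) by (auto simp: sublist_def)
  then have "length ps + length s + length ss = 2 * m"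
    by (metis add.assoc length_alt length_append)
  then have "alt m ! (length ps + q) \<noteq> alt m ! length ps"
    using len assms(2) distinct by (auto simp: nth_alt)
  moreover have "alt m ! (length ps + q) = s ! q" "alt m ! length ps = s ! 0"
    using len by (auto simp: alt nth_append)
  ultimately show False
    using assms(1) len by (auto simp: has_period_def)
qed

text \<open>Either \<open>s\<close> lies in the last run with its closing \<open>b\<close>, and has
  length at most \<open>q + 1\<close>, or it contains the whole run. Then
  \<open>2 * length c\<close> is at most \<open>q\<close>, and even the full bracket, of length
  \<open>5 * length c + 2\<close>, is short enough.\<close>

lemma suffix_wrap_period_bound:
  assumes per: "has_period q s" "odd q" and suf: "suffix s (wrap c)"
  shows "length s \<le> 3 * q + 2"
proof -
  let ?m = "length c"
  have "wrap c = (a # alt ?m @ c) @ alt ?m @ [b]" by (simp add: wrap_def)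
  then have "suffix s (alt ?m @ [b]) \<or> (\<exists>s'. s = s' @ alt ?m @ [b] \<and> suffix s' (a # alt ?m @ c))"
    using suf suffix_append by metis
  then consider "suffix s (alt ?m @ [b])" |
    s' where "s = s' @ alt ?m @ [b]" "suffix s' (a # alt ?m @ c)"
    by blast
  then show ?thesis
  proof cases
    case 1
    then consider "s = []" | t where "s = t @ [b]" "suffix t (alt ?m)" by auto
    then show ?thesis
    proof cases
      case 2
      then have "length t \<le> q"
        using per by (intro alternating_period_bound)
          (auto intro: has_period_sublist suffix_imp_sublist)
      then show ?thesis using 2 by simp
    qed simp
  next
    case 2
    have "sublist (alt ?m) s" unfolding 2(1) by (rule sublist_appendI)
    then have "length (alt ?m) \<le> q"
      using per alternating_period_bound has_period_sublist by blast
    moreover have "length s \<le> length (wrap c)"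
      using suf by (rule suffix_length_le)
    ultimately show ?thesis by (simp add: wrap_def)
  qed
qed

text \<open>The mirror image of the suffix case, using the first alternating run.\<close>

lemma prefix_wrap_period_bound:
  assumes per: "has_period q s" "odd q" and pre: "prefix s (wrap c)"
  shows "length s \<le> 3 * q + 2"
proof -
  let ?m = "length c"
  have "wrap c = (a # alt ?m) @ c @ alt ?m @ [b]" by (simp add: wrap_def)
  then consider "prefix s (a # alt ?m)" |
    s' where "s = (a # alt ?m) @ s'"
    using pre by (metis prefix_append)
  then show ?thesis
  proof cases
    case 1
    then consider "s = []" | t where "s = a # t" "prefix t (alt ?m)"
      by (auto simp: prefix_Cons)
    then show ?thesis
    proof cases
      case 2
      then have "sublist t s" by (simp add: sublist_Cons_right)
      then have "length t \<le> q"
        using per 2 by (meson alternating_period_bound has_period_sublist prefix_imp_sublist)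
      then show ?thesis using 2 by simp
    qed simp
  next
    case 2
    have "s = [a] @ alt ?m @ s'" using 2 by simp
    then have "sublist (alt ?m) s" by (metis sublist_appendI)
    then have "length (alt ?m) \<le> q"
      using per alternating_period_bound has_period_sublist by blast
    moreover have "length s \<le> length (wrap c)"
      using pre by (rule prefix_length_le)
    ultimately show ?thesis by (simp add: wrap_def)
  qed
qed

lemma height_take_period:
  assumes "has_period q w"
  shows "j + q \<le> length w \<Longrightarrow> height (take (j + q) w) = height (take j w) + height (take q w)"
proof (induction j)
  case (Suc j)
  then have eq: "w ! j = w ! (j + q)"
    using assms by (auto simp: has_period_def)
  have "take (Suc j) w = take j w @ [w ! j]"
    using Suc by (intro take_Suc_conv_app_nth) auto
  moreover have "take (Suc j + q) w = take (j + q) w @ [w ! (j + q)]"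
    using Suc by (simp add: take_Suc_conv_app_nth)
  ultimately show ?case using Suc eq by simp
qed simp

text \<open>The prefixes of lengths \<open>length w - q\<close> and \<open>q\<close> have
  nonnegative heights, which by periodicity add up to the height of \<open>w\<close>, that is, to 0.
  Both therefore vanish, and a prefix of length \<open>q\<close> and height 0 makes \<open>q\<close>
  even.\<close>

lemma balanced_even_period:
  assumes "balanced w" "has_period q w" "q \<le> length w"
  shows "even q"
proof -
  have pos: "0 \<le> height (take j w)" for j
    using assms(1) by (auto simp: balanced_def take_is_prefix)
  have "height (take (length w - q + q) w) = height (take (length w - q) w) + height (take q w)"
    using assms by (intro height_take_period) auto
  moreover have "height (take (length w - q + q) w) = 0"
    using assms by (auto simp: balanced_def)
  ultimately have "height (take q w) = 0"
    using pos [of q] pos [of "length w - q"] by linarith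
  then show ?thesis
    using even_height_iff [of "take q w"] assms(3) by simp
qed

text \<open>In the decomposition \<open>s @ e @ p\<close> the outer parts have length at most
  \<open>3 * q + 2\<close>, while \<open>e\<close> is shorter than \<open>q\<close> because it is
  balanced.\<close>

lemma factors_no_odd_period:
  assumes "f \<in> factors" "has_period q f" "odd q"
  shows "length f < 7 * q + 4"
proof -
  obtain d where d: "d \<in> code" "sublist f d" using assms(1) by (auto simp: factors_def)
  have "\<exists>c\<in>code. \<exists>e\<in>code. \<exists>c'\<in>code. \<exists>s p.
      f = s @ e @ p \<and> suffix s (wrap c) \<and> prefix p (wrap c')"
    using splits_code [OF d(1)] d(2) by (simp add: splits_def)
  then obtain c e c' s p where e: "e \<in> code" and f: "f = s @ e @ p"
    and s: "suffix s (wrap c)" and p: "prefix p (wrap c')"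
    by blast
  have "sublist s f" "sublist e f" "sublist p f"
    unfolding f using sublist_append_leftI [of p "s @ e"] by simp_all
  then have "has_period q s" "has_period q e" "has_period q p"
    using assms(2) has_period_sublist by blast+
  then have "length s \<le> 3 * q + 2" "length p \<le> 3 * q + 2" "length e < q"
    using suffix_wrap_period_bound [OF _ assms(3) s] prefix_wrap_period_bound [OF _ assms(3) p]
      balanced_even_period [OF balanced_code [OF e]] assms(3) by (simp_all add: not_less [symmetric])
      (metis not_less)
  then show ?thesis by (simp add: f)
qed

section \<open>Mixing\<close>

lemma factors_sublist: "f \<in> factors \<Longrightarrow> sublist g f \<Longrightarrow> g \<in> factors"
  by (auto simp: factors_def intro: sublist_order.order_trans)

text \<open>Inserting \<open>alt k\<close> between \<open>d\<close> and \<open>d'\<close> gives gaps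
  of one parity. Replacing \<open>d\<close> by \<open>wrap d\<close> puts
  \<open>alt (length d) @ [b]\<close>, of odd length, behind \<open>d\<close> and so gives the other
  parity.\<close>

lemma factors_mixing:
  assumes "u \<in> factors" "v \<in> factors"
  shows "\<exists>N>0. \<forall>n>N. \<exists>w. length w = n \<and> u @ w @ v \<in> factors"
proof -
  obtain d d' x y x' y' where d: "d \<in> code" "d = x @ u @ y" and d': "d' \<in> code" "d' = x' @ v @ y'"
    using assms by (auto simp: factors_def sublist_def)
  \<comment> \<open>The shortest gap behind \<open>wrap d\<close> has length
    \<open>length y + 2 * length d + 1 + length x'\<close>. Beyond it, none of the natural number
    subtractions below is truncated.\<close>
  define N where "N = length y + 2 * length d + 1 + length x' + 1"
  have "\<exists>w. length w = n \<and> u @ w @ v \<in> factors" if n: "n > N" for n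
  proof (cases "even (n - (length y + length x'))")
    case True
    then obtain k where k: "n - (length y + length x') = 2 * k" by blast
    have "d @ alt k @ d' \<in> code" by (intro code.append alt_code d d')
    moreover have "d @ alt k @ d' = x @ (u @ (y @ alt k @ x') @ v) @ y'"
      by (simp add: d d')
    ultimately have "u @ (y @ alt k @ x') @ v \<in> factors"
      unfolding factors_def using sublist_appendI by (metis mem_Collect_eq)
    moreover have "length (y @ alt k @ x') = n"
      using n k by (auto simp: N_def)
    ultimately show ?thesis by blast
  next
    case False
    let ?r = "n - (length y + 2 * length d + 1 + length x')"
    have "even ?r" using False n by (auto simp: N_def)
    then obtain k where k: "?r = 2 * k" by blast
    have "wrap d @ alt k @ d' \<in> code" by (intro code.intros alt_code d d')
    moreover have "wrap d @ alt k @ d' =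
        (a # alt (length d) @ x) @ (u @ (y @ alt (length d) @ [b] @ alt k @ x') @ v) @ y'"
      using d d' by (simp add: wrap_def)
    ultimately have "sublist (u @ (y @ alt (length d) @ [b] @ alt k @ x') @ v) (wrap d @ alt k @ d')"
      using sublist_appendI by metis
    then have "u @ (y @ alt (length d) @ [b] @ alt k @ x') @ v \<in> factors"
      unfolding factors_def using \<open>wrap d @ alt k @ d' \<in> code\<close> by blast
    moreover have "length (y @ alt (length d) @ [b] @ alt k @ x') = n"
      using n k by (auto simp: N_def)
    ultimately show ?thesis by blast
  qed
  then show ?thesis by (intro exI [of _ N]) (auto simp: N_def)
qed

end

theorem theorem5p5:
  fixes A :: "'a set"
  assumes "finite A" and "card A \<ge> 2"
  shows "\<exists>X. coded_system A X \<and> X \<noteq> {} \<and> mixing X \<and>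
           \<not> (\<exists>p x. odd p \<and> periodic_point X p x) \<and>
           (\<forall>Q. generators A Q X \<longrightarrow> (\<forall>w \<in> Q. even (length w)))"
proof -
  obtain a b where ab: "a \<in> A" "b \<in> A" "a \<noteq> b"
    using assms card_le_Suc0_iff_eq [OF assms(1)] by force
  interpret two_letters a b by unfold_locales (rule ab)
  interpret word_monoid A code
  proof
    show "countable A" using assms(1) by (rule countable_finite)
    show "code \<subseteq> lists A" using code_subset lists_mono [of "{a, b}" A] ab by auto
    have "alt 1 \<in> code" "alt 1 \<noteq> []" by (rule alt_code, simp)
    then show "\<exists>d\<in>code. d \<noteq> []" by blast
  qed (auto intro: code.intros)
  let ?X = "block_shift factors"
  have lang: "language ?X = factors"
    using language_block_shift by (simp add: factors_def)
  have no_odd: "\<not> periodic_point ?X p x" if odd: "odd p" for p x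
  proof
    assume "periodic_point ?X p x"
    then have x: "x \<in> ?X" "x (i + int p) = x i" for i
      by (auto simp: periodic_point_def shift_funpow dest: fun_cong)
    \<comment> \<open>\<open>7 * p + 4\<close> is the first length excluded by the bound for the odd
      period \<open>p\<close>.\<close>
    let ?f = "block x 0 (7 * p + 4)"
    have "?f \<in> factors" using x(1) by (simp add: block_shift_def)
    moreover have "has_period p ?f"
      using x(2) by (simp add: has_period_def)
    ultimately show False using factors_no_odd_period [OF _ _ odd, of ?f] by simp
  qed
  have "coded_system A ?X" using coded_system_block_shift by (simp add: factors_def)
  \<comment> \<open>The empty word lies in the language, and every word there is a block of some
    point.\<close>
  moreover have "?X \<noteq> {}"
    using lang code.Nil by (auto simp: language_def factors_def)
  moreover have "mixing ?X"
    unfolding mixing_def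
  proof (intro ballI)
    fix u v assume "u \<in> language ?X" "v \<in> language ?X"
    then obtain N where N: "N > 0" "\<And>n. n > N \<Longrightarrow> \<exists>w. length w = n \<and> u @ w @ v \<in> factors"
      using factors_mixing [of u v] by (auto simp: lang)
    have "\<exists>w\<in>language_n n ?X. u @ w @ v \<in> language ?X" if n: "n > N" for n
    proof -
      obtain w where w: "length w = n" "u @ w @ v \<in> factors" using N(2) [OF n] by blast
      then have "w \<in> factors" using factors_sublist sublist_appendI by blast
      then show ?thesis using w by (auto simp: language_n_def lang)
    qed
    then show "\<exists>N>0. \<forall>n>N. \<exists>w\<in>language_n n ?X. u @ w @ v \<in> language ?X"
      using N(1) by blast
  qed
  ultimately show ?thesis
    using no_odd generators_odd_word by (intro exI [of _ ?X]) blast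
qed

end
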